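(* There exists a universal constant $\mathfrak C_2>0$ such that the following holds. Let $\mathfrak X$ be an infinite countable set, let $\mathcal F=\{1_C:C\subset\mathfrak X\}$ and let $\mathbf P_0$ be a probability measure on $\mathfrak X$. Define, for $k\in\mathbb N$, $$\mathbf j_{\mathbf P_0}(k)=\min\Big\{J\in\mathbb N:\ \sum_{y\in\mathfrak X:\ \mathbf P_0(\{y\})\le16^{-J}}\mathbf P_0(\{y\})\le4^{-k}\Big\}.$$ Then, for all integers $p\ge1$, $$J_{[]}\big(2^{-(p-1)},\mathcal F,\mathbf P_0\big)\le\mathfrak C_2\sqrt{\sum_{y\in\mathfrak X}\sqrt{\mathbf P_0(\{y\})}}\times\sqrt{\sum_{y:\ \mathbf P_0(\{y\})\le16^{-\mathbf j_{\mathbf P_0}(p)+1}}\sqrt{\mathbf P_0(\{y\})}}.$$ Moreover, if the support of $\mathbf P_0$ is infinite, then $\mathbf j_{\mathbf P_0}(p)\to\infty$ as $p\to\infty$.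
   Context: $\mathbb N=\{0,1,2,\dots\}$. $\mathfrak X$ carries the $\sigma$-algebra of all its subsets. The sums on the right-hand side may be infinite. The bracket $[f^-,f^+]$ between two real functions on $\mathfrak X$ is the set of functions $f$ with $f^-\le f\le f^+$ everywhere. $N_{[]}(\varepsilon,\mathcal F,\|\cdot\|_{Q,2})$ is the minimal number of brackets with $\|f^+-f^-\|_{Q,2}$ less than $\varepsilon$ needed to cover $\mathcal F$, where $\|g\|_{Q,2}=(\int g^2dQ)^{1/2}$, and $J_{[]}(\delta,\mathcal F,Q)=\int_0^\delta\sqrt{\log N_{[]}(\varepsilon,\mathcal F,\|\cdot\|_{Q,2})}\,d\varepsilon$ for $\delta\in(0,\infty]$. *)

theory Defs
  imports "HOL-Analysis.Analysis" "HOL-Probability.Probability_Measure"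
begin

definition ennsqrt :: "ennreal \<Rightarrow> ennreal" where
  "ennsqrt x = (if x = \<infinity> then \<infinity> else ennreal (sqrt (enn2real x)))"

(* Valued in ennreal so that functions that are not square-integrable have norm \<infinity>
   (the Bochner integral would give them norm 0). *)
definition L2_enorm :: "'a measure \<Rightarrow> ('a \<Rightarrow> real) \<Rightarrow> ennreal" where
  "L2_enorm Q g = ennsqrt (\<integral>\<^sup>+x. ennreal ((g x)\<^sup>2) \<partial>Q)"

(* A bracket with bounding functions l and u is only ever needed here for measures whose
   sigma-algebra is the power set, so no measurability of l and u is demanded.
   Real functions on X are represented by functions on the whole type; values outside X are ignored. *)
definition bracket :: "'a set \<Rightarrow> ('a \<Rightarrow> real) \<Rightarrow> ('a \<Rightarrow> real) \<Rightarrow> ('a \<Rightarrow> real) set" where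
  "bracket X l u = {f. \<forall>x\<in>X. l x \<le> f x \<and> f x \<le> u x}"

(* If no finite cover exists, this is Inf {} = \<infinity>. *)
definition bracketing_number ::
    "real \<Rightarrow> ('a \<Rightarrow> real) set \<Rightarrow> 'a measure \<Rightarrow> enat" where
  "bracketing_number \<epsilon> F Q =
     Inf {enat (card B) | B. finite B \<and>
       (\<forall>(l, u)\<in>B. L2_enorm Q (\<lambda>x. u x - l x) < ennreal \<epsilon>) \<and>
       F \<subseteq> (\<Union>(l, u)\<in>B. bracket (space Q) l u)}"

definition sqrt_log :: "enat \<Rightarrow> ennreal" where
  "sqrt_log N = (case N of enat n \<Rightarrow> ennreal (sqrt (ln (real n))) | \<infinity> \<Rightarrow> \<infinity>)"

definition bracketing_integral ::
    "ereal \<Rightarrow> ('a \<Rightarrow> real) set \<Rightarrow> 'a measure \<Rightarrow> ennreal" where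
  "bracketing_integral \<delta> F Q =
     (\<integral>\<^sup>+\<epsilon>\<in>einterval 0 \<delta>. sqrt_log (bracketing_number \<epsilon> F Q) \<partial>lborel)"

definition indicators :: "'a set \<Rightarrow> ('a \<Rightarrow> real) set" where
  "indicators X = {indicator C | C. C \<subseteq> X}"

definition small_atoms :: "'a measure \<Rightarrow> real \<Rightarrow> 'a set" where
  "small_atoms P t = {y \<in> space P. measure P {y} \<le> t}"

definition jj :: "'a measure \<Rightarrow> nat \<Rightarrow> nat" where
  "jj P k = (LEAST J. (\<Sum>\<^sub>\<infinity>y\<in>small_atoms P (16 powi (- int J)). ennreal (measure P {y}))
                        \<le> ennreal (4 powi (- int k)))"

(* An existential quantifier inside a theorem about measures on an arbitrary type 'a would only
   give a constant for each 'a.  To have one constant for all carriers of all types, C2 is some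
   constant that works for all carriers consisting of natural numbers; that it is positive and
   works for every infinite countable carrier, in any type, is then a claim to be proved. *)
definition C2 :: real where
  "C2 = (SOME C. C > 0 \<and>
     (\<forall>(X :: nat set) P. infinite X \<and> countable X \<and>
        prob_space P \<and> space P = X \<and> sets P = Pow X \<longrightarrow>
        (\<forall>p::nat. p \<ge> 1 \<longrightarrow>
           bracketing_integral (ereal (2 powi (- (int p - 1)))) (indicators X) P
           \<le> ennreal C
              * ennsqrt (\<Sum>\<^sub>\<infinity>y\<in>X. ennreal (sqrt (measure P {y})))
              * ennsqrt (\<Sum>\<^sub>\<infinity>y\<in>small_atoms P (16 powi (- int (jj P p) + 1)).
                           ennreal (sqrt (measure P {y}))))))"

end

theory Submission
  imports Defs
begin

text \<open>
Write \<open>T K\<close> for the total mass of the atoms of mass at most \<open>16\<^sup>-\<^sup>K\<close> and \<open>N K\<close> for the number of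
the remaining, heavier atoms, which is finite. A set \<open>C\<close> can be bracketed by prescribing it exactly
on the heavy atoms and leaving it free on the light ones. This uses \<open>2\<^bsup>N K\<^esup>\<close> brackets of size
\<open>sqrt (T K)\<close>, so the square root of the entropy at scale \<open>\<epsilon>\<close> is at most \<open>sqrt (N K)\<close> as soon as
\<open>sqrt (T K) < \<epsilon>\<close> (\<open>sqrt_log_bracketing_number_le\<close>).

Let \<open>m + 1 = jj P p\<close>, so that \<open>T (m + 1) \<le> 4\<^sup>-\<^sup>p < T m\<close>. Each
\<open>\<epsilon> < 2\<^bsup>1 - p\<^esup>\<close> is below \<open>2 sqrt (T m)\<close>, and the least admissible level \<open>K + 1 > m\<close> for \<open>\<epsilon>\<close>
satisfies \<open>\<epsilon> \<le> 2 sqrt (T K)\<close>. Slicing the integral along the levels \<open>T K\<close> instead of along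
powers of two therefore bounds it by \<open>2 \<Sum>K\<ge>m. sqrt (N (K + 1) * T K)\<close>
(\<open>bracketing_integral_le_suminf\<close>).

Bounding these terms one at a time would lose the summability. The Cauchy-Schwarz inequality with
weights \<open>4\<^bsup>K + 1\<^esup>\<close> splits the sum into the square roots of \<open>\<Sum>K. N (K + 1) / 4\<^bsup>K + 1\<^esup>\<close> and
\<open>\<Sum>K\<ge>m. 4\<^bsup>K + 1\<^esup> * T K\<close>. Exchanging summation over levels and atoms makes both sums geometric: an
atom of mass \<open>q\<close> enters the first one only at levels with \<open>4\<^sup>-\<^sup>K < sqrt q\<close>, hence contributes at
most \<open>4/3 * sqrt q\<close>; it enters the second one only if it is light at level \<open>m\<close> and at levels with
\<open>4\<^sup>K \<le> 1 / sqrt q\<close>, hence contributes at most \<open>16/3 * sqrt q\<close> (\<open>suminf_card_large_le\<close> and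
\<open>suminf_prob_small_le\<close>). The resulting constant is \<open>16/3\<close>.

All quantities are invariant under relabelling the atoms, so a constant that works for carriers
consisting of natural numbers serves every infinite countable carrier
(\<open>entropy_bound_of_distr\<close>). Finally, infinite support means \<open>T K > 0\<close> for all \<open>K\<close>, so a tail
mass below \<open>4\<^sup>-\<^sup>k\<close> forces an ever larger index as \<open>k\<close> grows.
\<close>

section \<open>Square roots and infinite sums in the extended nonnegative reals\<close>

lemma ennsqrt_mono: "x \<le> y \<Longrightarrow> ennsqrt x \<le> ennsqrt y"
  unfolding ennsqrt_def by (cases x; cases y) (auto simp: top_unique intro!: ennreal_leI)

lemma ennsqrt_ennreal: "0 \<le> r \<Longrightarrow> ennsqrt (ennreal r) = ennreal (sqrt r)"
  unfolding ennsqrt_def by simp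

lemma ennsqrt_top [simp]: "ennsqrt top = top"
  unfolding ennsqrt_def by simp

lemma ennsqrt_0 [simp]: "ennsqrt 0 = 0"
  unfolding ennsqrt_def by simp

lemma ennsqrt_power2: "ennsqrt (x\<^sup>2) = x"
  by (cases x) (auto simp: ennsqrt_ennreal ennreal_power power2_eq_square ennreal_mult_top
      simp flip: ennreal_mult)

lemma ennsqrt_mult: "ennsqrt (x * y) = ennsqrt x * ennsqrt y"
proof (cases x; cases y)
  fix r s :: real assume "0 \<le> r" "x = ennreal r" "0 \<le> s" "y = ennreal s"
  then show ?thesis
    by (simp add: ennsqrt_ennreal real_sqrt_mult flip: ennreal_mult)
qed (auto simp: ennsqrt_ennreal ennreal_mult_top ennreal_top_mult)

lemma sqrt_log_mono: "M \<le> N \<Longrightarrow> sqrt_log M \<le> sqrt_log N"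
proof (cases M; cases N)
  fix m n assume "M \<le> N" "M = enat m" "N = enat n"
  then show ?thesis
    by (cases "m = 0") (auto simp: sqrt_log_def intro!: ennreal_leI)
qed (auto simp: sqrt_log_def)

lemma suminf_ge_term: "f K \<le> (\<Sum>K. f K)" for f :: "nat \<Rightarrow> ennreal"
  using sum_le_suminf[of f "{K}"] by simp

lemma suminf_Cauchy_Schwarz:
  fixes f g :: "nat \<Rightarrow> ennreal"
  shows "(\<Sum>K. f K * g K) \<le> ennsqrt (\<Sum>K. (f K)\<^sup>2) * ennsqrt (\<Sum>K. (g K)\<^sup>2)"
proof -
  have "(\<Sum>K. f K * g K)\<^sup>2 \<le> (\<Sum>K. (f K)\<^sup>2) * (\<Sum>K. (g K)\<^sup>2)"
    using Cauchy_Schwarz_nn_integral[of f "count_space UNIV" g]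
    by (simp add: nn_integral_count_space_nat)
  from ennsqrt_mono[OF this] show ?thesis
    by (simp add: ennsqrt_power2 ennsqrt_mult)
qed

lemma infsum_eq_nn_integral_count_space:
  fixes f :: "'a \<Rightarrow> ennreal"
  assumes "countable A"
  shows "(\<Sum>\<^sub>\<infinity>y\<in>A. f y) = (\<integral>\<^sup>+y. f y \<partial>count_space A)"
proof (cases "finite A")
  case True
  then show ?thesis by (simp add: nn_integral_count_space_finite)
next
  case False
  have sup: "infsum f A = (SUP F\<in>{F. finite F \<and> F \<subseteq> A}. sum f F)"
    by (rule nonneg_infsum_complete) auto
  have bij: "bij_betw (from_nat_into A) UNIV A"
    using assms False by (rule bij_betw_from_nat_into)
  show ?thesis
  proof (rule antisym)
    show "infsum f A \<le> (\<integral>\<^sup>+y. f y \<partial>count_space A)"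
      unfolding sup
    proof (rule SUP_least)
      fix F assume F: "F \<in> {F. finite F \<and> F \<subseteq> A}"
      then have "sum f F = (\<integral>\<^sup>+y. f y \<partial>count_space F)"
        by (simp add: nn_integral_count_space_finite)
      also have "\<dots> \<le> (\<integral>\<^sup>+y. f y \<partial>count_space A)"
        using F by (auto simp: nn_integral_count_space_indicator intro!: nn_integral_mono
            split: split_indicator)
      finally show "sum f F \<le> (\<integral>\<^sup>+y. f y \<partial>count_space A)" .
    qed
    have "(\<integral>\<^sup>+y. f y \<partial>count_space A) = (\<Sum>n. f (from_nat_into A n))"
      by (simp add: nn_integral_bij_count_space[OF bij, symmetric] nn_integral_count_space_nat)
    also have "\<dots> = (SUP n. \<Sum>i<n. f (from_nat_into A i))"
      by (rule suminf_eq_SUP)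
    also have "\<dots> \<le> infsum f A"
    proof (rule SUP_least)
      fix n
      have "inj_on (from_nat_into A) {..<n}"
        using bij by (meson bij_betw_def inj_on_subset subset_UNIV)
      then have "(\<Sum>i<n. f (from_nat_into A i)) = sum f (from_nat_into A ` {..<n})"
        by (simp add: sum.reindex)
      also have "\<dots> \<le> infsum f A"
        unfolding sup using bij by (intro SUP_upper) (auto simp: bij_betw_def)
      finally show "(\<Sum>i<n. f (from_nat_into A i)) \<le> infsum f A" .
    qed
    finally show "(\<integral>\<^sup>+y. f y \<partial>count_space A) \<le> infsum f A" .
  qed
qed

section \<open>Dyadic sums\<close>

text \<open>
A geometric sum is comparable to its largest term, here a power below \<open>s\<close>. Multiplying \<open>s\<close> by 4
shifts the index by one, which gives an induction without naming that largest term.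
\<close>

lemma sum_quarter_powers_below:
  fixes s :: real
  assumes "0 \<le> s"
  shows "(\<Sum>K<n. (1/4) ^ K * (if (1/4) ^ K < s then 1 else 0)) \<le> 4/3 * s"
  using assms
proof (induction n arbitrary: s)
  case (Suc n)
  show ?case
  proof (cases "1 < s")
    case True
    have "(\<Sum>K<Suc n. (1/4) ^ K * (if (1/4) ^ K < s then 1 else 0)) \<le> (\<Sum>K<Suc n. (1/4::real) ^ K)"
      by (intro sum_mono) auto
    also have "\<dots> = 4/3 - 1/3 * (1/4) ^ n"
      by (induction n) auto
    also have "\<dots> \<le> 4/3"
      by simp
    finally show ?thesis using True by simp
  next
    case False
    have "(\<Sum>K<Suc n. (1/4) ^ K * (if (1/4) ^ K < s then 1 else (0::real)))
        = 1/4 * (\<Sum>K<n. (1/4) ^ K * (if (1/4) ^ K < 4 * s then 1 else 0))"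
      using False by (subst sum.lessThan_Suc_shift) (auto simp: sum_distrib_left intro!: sum.cong)
    also have "\<dots> \<le> 1/4 * (4/3 * (4 * s))"
      using Suc.prems by (intro mult_left_mono Suc.IH) auto
    finally show ?thesis by simp
  qed
qed simp

lemma sum_powers_of_four_below:
  fixes t :: real
  assumes "0 \<le> t"
  shows "(\<Sum>K<n. 4 ^ K * (if 4 ^ K \<le> t then 1 else 0)) \<le> 4/3 * t"
proof (induction n)
  case (Suc n)
  show ?case
  proof (cases "4 ^ n \<le> t")
    case True
    have "(\<Sum>K<Suc n. 4 ^ K * (if 4 ^ K \<le> t then 1 else 0)) \<le> (\<Sum>K<Suc n. (4::real) ^ K)"
      by (intro sum_mono) auto
    also have "\<dots> \<le> 4/3 * 4 ^ n"
      by (simp only: geometric_sum) simp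
    finally show ?thesis using True by simp
  qed (use Suc in simp)
qed (use assms in simp)

lemma powi_neg_eq: "(16::real) powi (- int J) = (1/16) ^ J"
  by (simp add: power_int_minus power_one_over inverse_eq_divide)

lemma sqrt_sixteenth_power: "sqrt ((1/16) ^ J) = (1/4) ^ J"
proof -
  have "(1/16::real) ^ J = ((1/4) ^ J)\<^sup>2"
    by (simp add: power2_eq_square flip: power_mult_distrib)
  then show ?thesis by simp
qed

section \<open>Discrete probability spaces\<close>

text \<open>
The sets of light and heavy atoms are indexed by the exponent of the threshold \<open>16\<^sup>-\<^sup>K\<close>. They are
used through the equivalent condition on the square root of the mass, whose threshold is \<open>4\<^sup>-\<^sup>K\<close>.
\<close>

locale discrete_prob_space = prob_space P for P :: "'a measure" +
  assumes sets_eq: "sets P = Pow (space P)" and countable_space: "countable (space P)"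
begin

definition small :: "nat \<Rightarrow> 'a set" where
  "small K = small_atoms P (16 powi (- int K))"

definition large :: "nat \<Rightarrow> 'a set" where
  "large K = space P - small K"

lemma small_iff: "y \<in> small K \<longleftrightarrow> y \<in> space P \<and> sqrt (prob {y}) \<le> (1/4) ^ K"
  unfolding small_def small_atoms_def powi_neg_eq sqrt_sixteenth_power[symmetric]
  by (simp only: real_sqrt_le_iff) simp

lemma large_iff: "y \<in> large K \<longleftrightarrow> y \<in> space P \<and> (1/4) ^ K < sqrt (prob {y})"
  unfolding large_def by (auto simp: small_iff)

lemma small_subset: "small K \<subseteq> space P"
  by (auto simp: small_iff)

lemma small_antimono: "K \<le> L \<Longrightarrow> small L \<subseteq> small K"
proof
  fix y assume "K \<le> L" "y \<in> small L"
  then have "y \<in> space P" "sqrt (prob {y}) \<le> (1/4) ^ L" "(1/4) ^ L \<le> (1/4 :: real) ^ K"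
    by (auto simp only: small_iff intro!: power_decreasing)
  then show "y \<in> small K"
    unfolding small_iff by linarith
qed

lemma small_in_sets [simp]: "small K \<in> sets P"
  using small_subset by (simp add: sets_eq)

lemma measurable_all [simp]: "f \<in> borel_measurable P"
  by (simp add: measurable_def sets_eq)

text \<open>At most \<open>16\<^sup>K\<close> atoms of mass above \<open>16\<^sup>-\<^sup>K\<close> fit into total mass 1.\<close>

lemma finite_large: "finite (large K)"
proof (rule ccontr)
  assume "infinite (large K)"
  then obtain F where F: "finite F" "card F = Suc (16 ^ K)" "F \<subseteq> large K"
    using infinite_arbitrarily_large by blast
  have *: "(1/16) ^ K \<le> prob {y}" if "y \<in> F" for y
    using that F(3) unfolding large_def small_def small_atoms_def powi_neg_eq by auto
  have "1 < real (card F) * (1/16) ^ K"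
    by (simp add: F(2) power_one_over field_simps)
  also have "\<dots> \<le> (\<Sum>y\<in>F. prob {y})"
    using sum_mono[of F "\<lambda>_. (1/16) ^ K", OF *] by simp
  also have "\<dots> = prob F"
    using F by (intro finite_measure_eq_sum_singleton[symmetric]) (auto simp: sets_eq large_iff)
  finally show False using prob_le_1[of F] by simp
qed

lemma emeasure_eq_nn_integral:
  "A \<subseteq> space P \<Longrightarrow> emeasure P A = (\<integral>\<^sup>+y. ennreal (prob {y}) \<partial>count_space A)"
  by (subst emeasure_countable_singleton)
     (auto simp: sets_eq emeasure_eq_measure intro: countable_subset[OF _ countable_space])

lemma jj_eq: "jj P k = (LEAST J. prob (small J) \<le> (1/4) ^ k)"
proof -
  have "(\<Sum>\<^sub>\<infinity>y\<in>small_atoms P (16 powi (- int J)). ennreal (prob {y})) = ennreal (prob (small J))" for J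
    using infsum_eq_nn_integral_count_space[of "small J" "\<lambda>y. ennreal (prob {y})"]
      emeasure_eq_nn_integral[of "small J"] small_subset[of J]
    by (simp add: small_def[symmetric] countable_subset[OF _ countable_space] emeasure_eq_measure)
  then show ?thesis
    unfolding jj_def by (simp add: power_int_minus power_one_over inverse_eq_divide)
qed

text \<open>
The sets of light atoms decrease to the set of points of mass zero, which is null because it is
countable. This makes the minimum in the definition of \<open>jj\<close> exist.
\<close>

lemma prob_small_tendsto_0: "(\<lambda>K. prob (small K)) \<longlonglongrightarrow> 0"
proof -
  have "(\<lambda>K. prob (small K)) \<longlonglongrightarrow> prob (\<Inter>K. small K)"
    by (rule finite_Lim_measure_decseq) (auto simp: decseq_def small_antimono)
  moreover have "prob (\<Inter>K. small K) = 0"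
  proof -
    have sub: "(\<Inter>K. small K) \<subseteq> space P"
      using small_subset by blast
    have zero: "prob {y} = 0" if "y \<in> (\<Inter>K. small K)" for y
    proof -
      have "sqrt (prob {y}) \<le> 0"
      proof (rule LIMSEQ_le_const)
        show "(\<lambda>K. (1/4) ^ K) \<longlonglongrightarrow> (0::real)"
          by (rule LIMSEQ_power_zero) simp
        show "\<exists>N. \<forall>n\<ge>N. sqrt (prob {y}) \<le> (1/4) ^ n"
          using that by (auto simp: small_iff)
      qed
      then show ?thesis
        using measure_nonneg[of P "{y}"] by simp
    qed
    have "emeasure P (\<Inter>K. small K) = 0"
      unfolding emeasure_eq_nn_integral[OF sub]
      by (subst nn_integral_0_iff_AE) (auto simp: AE_count_space zero)
    then show ?thesis by (simp add: measure_def)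
  qed
  ultimately show ?thesis by simp
qed

lemma ex_prob_small_less: "0 < c \<Longrightarrow> \<exists>K. prob (small K) < c"
  using order_tendstoD(2)[OF prob_small_tendsto_0] by (auto simp: eventually_sequentially)

lemma prob_small_antimono: "K \<le> L \<Longrightarrow> prob (small L) \<le> prob (small K)"
  by (intro finite_measure_mono small_antimono) auto

lemma prob_small_jj: "prob (small (jj P k)) \<le> (1/4) ^ k"
  unfolding jj_eq
proof (rule LeastI_ex)
  show "\<exists>J. prob (small J) \<le> (1/4) ^ k"
    using ex_prob_small_less[of "(1/4) ^ k"] by (auto intro: less_imp_le)
qed

lemma prob_small_before_jj: "J < jj P k \<Longrightarrow> (1/4) ^ k < prob (small J)"
  unfolding jj_eq using not_less_Least[of J] by force

text \<open>
At level 0 every point counts as light, with total mass \<open>1 > 4\<^sup>-\<^sup>k\<close>. Hence \<open>jj\<close> has a predecessor,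
at which \<open>prob_small_before_jj\<close> bounds the mass from below.
\<close>

lemma jj_pos: "1 \<le> k \<Longrightarrow> 0 < jj P k"
proof (rule ccontr)
  assume "1 \<le> k" "\<not> 0 < jj P k"
  then have "prob (small 0) \<le> (1/4) ^ k"
    using prob_small_jj[of k] by simp
  moreover have "small 0 = space P"
    by (auto simp: small_iff)
  moreover have "(1/4::real) ^ k < 1"
    using \<open>1 \<le> k\<close> by (simp add: power_Suc_less_one power_less_one_iff)
  ultimately show False by (simp add: prob_space)
qed

text \<open>
Only finitely many atoms are heavy at a given level \<open>Z\<close>, so with infinite support some positive mass
stays light there; once \<open>4\<^sup>-\<^sup>k\<close> is below it, \<open>jj P k\<close> has passed \<open>Z\<close>.
\<close>

lemma filterlim_jj:
  assumes "infinite {y \<in> space P. prob {y} > 0}"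
  shows "filterlim (jj P) at_top at_top"
  unfolding filterlim_at_top
proof
  fix Z :: nat
  have "infinite ({y \<in> space P. prob {y} > 0} - large Z)"
    using assms finite_large by (rule Diff_infinite_finite[rotated])
  then obtain y where y: "y \<in> small Z" "prob {y} > 0"
    by (auto simp: large_def dest!: infinite_imp_nonempty)
  have pos: "0 < prob (small Z)"
    using y finite_measure_mono[of "{y}" "small Z"] by auto
  have "(\<lambda>k. (1/4) ^ k) \<longlonglongrightarrow> (0::real)"
    by (rule LIMSEQ_power_zero) simp
  then have "\<forall>\<^sub>F k in sequentially. (1/4) ^ k < prob (small Z)"
    using pos by (rule order_tendstoD(2))
  then show "\<forall>\<^sub>F k in sequentially. Z \<le> jj P k"
  proof eventually_elim
    case (elim k)
    show ?case
    proof (rule ccontr)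
      assume "\<not> Z \<le> jj P k"
      then show False
        using prob_small_antimono[of "jj P k" Z] prob_small_jj[of k] elim by simp
    qed
  qed
qed

section \<open>The bracketing entropy of the class of all indicators\<close>

text \<open>
The bracket attached to a set \<open>D\<close> of heavy atoms contains the indicators of exactly those sets
whose heavy part is \<open>D\<close>; its upper and lower function differ by the indicator of the light atoms,
whatever \<open>D\<close> is.
\<close>

lemma bracketing_number_indicators_le:
  assumes "sqrt (prob (small K)) < \<epsilon>"
  shows "bracketing_number \<epsilon> (indicators (space P)) P \<le> enat (2 ^ card (large K))"
proof -
  define br :: "'a set \<Rightarrow> ('a \<Rightarrow> real) \<times> ('a \<Rightarrow> real)"
    where "br D = (indicator D, indicator (D \<union> small K))" for D
  define B where "B = br ` Pow (large K)"
  have norm: "L2_enorm P (\<lambda>x. indicator (D \<union> small K) x - indicator D x) < ennreal \<epsilon>"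
    if "D \<subseteq> large K" for D
  proof -
    have "(\<integral>\<^sup>+x. ennreal ((indicator (D \<union> small K) x - indicator D x)\<^sup>2) \<partial>P)
        = (\<integral>\<^sup>+x. indicator (small K) x \<partial>P)"
      using that by (intro nn_integral_cong) (auto simp: large_def split: split_indicator)
    also have "\<dots> = ennreal (prob (small K))"
      by (simp add: emeasure_eq_measure)
    finally show ?thesis
      using assms unfolding L2_enorm_def by (simp add: ennsqrt_ennreal ennreal_lessI
        order.strict_trans1[OF real_sqrt_ge_zero[OF measure_nonneg] assms])
  qed
  have "indicator C \<in> bracket (space P) (fst (br (C \<inter> large K))) (snd (br (C \<inter> large K)))"
    if "C \<subseteq> space P" for C
    using that by (auto simp: br_def bracket_def large_def split: split_indicator)
  moreover have "br (C \<inter> large K) \<in> B" for C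
    by (simp add: B_def)
  ultimately have cover: "indicators (space P) \<subseteq> (\<Union>(l, u)\<in>B. bracket (space P) l u)"
    unfolding indicators_def case_prod_beta by blast
  have "bracketing_number \<epsilon> (indicators (space P)) P \<le> enat (card B)"
    unfolding bracketing_number_def
  proof (rule Inf_lower, rule CollectI, intro exI[of _ B] conjI refl cover)
    show "finite B"
      by (simp add: B_def finite_large)
    show "\<forall>(l, u)\<in>B. L2_enorm P (\<lambda>x. u x - l x) < ennreal \<epsilon>"
      using norm by (auto simp: B_def br_def)
  qed
  also have "card B \<le> 2 ^ card (large K)"
    unfolding B_def using card_image_le[of "Pow (large K)" br] finite_large
    by (simp add: card_Pow)
  finally show ?thesis by simp
qed

lemma sqrt_log_bracketing_number_le:
  assumes "sqrt (prob (small K)) < \<epsilon>"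
  shows "sqrt_log (bracketing_number \<epsilon> (indicators (space P)) P) \<le> ennreal (sqrt (card (large K)))"
proof -
  have "sqrt_log (bracketing_number \<epsilon> (indicators (space P)) P) \<le> sqrt_log (enat (2 ^ card (large K)))"
    by (intro sqrt_log_mono bracketing_number_indicators_le assms)
  also have "\<dots> \<le> ennreal (sqrt (card (large K)))"
    using ln_2_less_1 by (auto simp: sqrt_log_def ln_realpow intro!: ennreal_leI mult_left_le)
  finally show ?thesis .
qed

text \<open>
The sum over all levels dominates the one term that matters: the first admissible level \<open>K + 1\<close>.
The factor 2 covers the case \<open>K = m\<close>, where the only upper bound on \<open>\<epsilon>\<close> is the end of the
integration range; for \<open>K > m\<close> inadmissibility of level \<open>K\<close> gives \<open>\<epsilon> \<le> sqrt (prob (small K))\<close>.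
\<close>

lemma sqrt_log_bracketing_number_le_suminf:
  assumes "0 < \<epsilon>" "\<epsilon> < 2 * sqrt (prob (small m))"
  shows "sqrt_log (bracketing_number \<epsilon> (indicators (space P)) P)
     \<le> (\<Sum>K. (if m \<le> K then ennreal (sqrt (card (large (Suc K)))) else 0)
             * indicator {0..2 * sqrt (prob (small K))} \<epsilon>)" (is "_ \<le> (\<Sum>K. ?f K)")
proof -
  define K where "K = (LEAST K. m \<le> K \<and> sqrt (prob (small (Suc K))) < \<epsilon>)"
  obtain L where "prob (small L) < \<epsilon>\<^sup>2"
    using ex_prob_small_less[of "\<epsilon>\<^sup>2"] assms by auto
  then have "prob (small (Suc (max L m))) < \<epsilon>\<^sup>2"
    using prob_small_antimono[of L "Suc (max L m)"] by linarith
  then have "sqrt (prob (small (Suc (max L m)))) < \<epsilon>"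
    using assms by (simp add: real_less_lsqrt)
  then have "m \<le> max L m \<and> sqrt (prob (small (Suc (max L m)))) < \<epsilon>"
    by simp
  then have K: "m \<le> K \<and> sqrt (prob (small (Suc K))) < \<epsilon>"
    unfolding K_def by (rule LeastI)
  have "\<epsilon> \<le> 2 * sqrt (prob (small K))"
  proof (cases "K = m")
    case False
    with K obtain K' where K': "K = Suc K'" "m \<le> K'"
      by (cases K) auto
    then have "\<not> (m \<le> K' \<and> sqrt (prob (small (Suc K'))) < \<epsilon>)"
      using not_less_Least[of K' "\<lambda>K. m \<le> K \<and> sqrt (prob (small (Suc K))) < \<epsilon>"]
      by (simp flip: K_def)
    then show ?thesis
      using K'(2) real_sqrt_ge_zero[OF measure_nonneg, of P "small K"]
      unfolding K'(1) by linarith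
  qed (use assms in simp)
  then have "sqrt_log (bracketing_number \<epsilon> (indicators (space P)) P) \<le> ?f K"
    using sqrt_log_bracketing_number_le[of "Suc K" \<epsilon>] K assms by simp
  also have "\<dots> \<le> (\<Sum>K. ?f K)"
    by (rule suminf_ge_term)
  finally show ?thesis .
qed

lemma bracketing_integral_le_suminf:
  assumes "\<delta> \<le> 2 * sqrt (prob (small m))"
  shows "bracketing_integral (ereal \<delta>) (indicators (space P)) P
    \<le> (\<Sum>K. (if m \<le> K then ennreal (sqrt (card (large (Suc K)))) else 0)
            * ennreal (2 * sqrt (prob (small K))))"
proof -
  have "bracketing_integral (ereal \<delta>) (indicators (space P)) P
    \<le> (\<integral>\<^sup>+\<epsilon>. (\<Sum>K. (if m \<le> K then ennreal (sqrt (card (large (Suc K)))) else 0)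
             * indicator {0..2 * sqrt (prob (small K))} \<epsilon>) \<partial>lborel)"
    unfolding bracketing_integral_def using assms
    by (intro nn_integral_mono)
       (auto simp: einterval_iff split: split_indicator intro!: sqrt_log_bracketing_number_le_suminf)
  also have "\<dots> = (\<Sum>K. (\<integral>\<^sup>+\<epsilon>. (if m \<le> K then ennreal (sqrt (card (large (Suc K)))) else 0)
             * indicator {0..2 * sqrt (prob (small K))} \<epsilon> \<partial>lborel))"
    by (rule nn_integral_suminf) measurable
  also have "\<dots> = (\<Sum>K. (if m \<le> K then ennreal (sqrt (card (large (Suc K)))) else 0)
            * ennreal (2 * sqrt (prob (small K))))"
    by (simp add: nn_integral_cmult)
  finally show ?thesis .
qed

text \<open>
The counting side of the Cauchy-Schwarz inequality. After exchanging the sums, an atom of mass \<open>q\<close>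
collects the powers \<open>4\<^sup>-\<^sup>K\<close> that are below \<open>sqrt q\<close>.
\<close>

lemma suminf_card_large_le:
  "(\<Sum>K. ennreal (card (large (Suc K)) * (1/4) ^ Suc K))
     \<le> ennreal (4/3) * (\<integral>\<^sup>+y. ennreal (sqrt (prob {y})) \<partial>count_space (space P))"
proof -
  define h where "h K y = ennreal ((1/4) ^ K * (if (1/4) ^ K < sqrt (prob {y}) then 1 else 0))"
    for K :: nat and y
  have "ennreal (card (large K) * (1/4) ^ K) = (\<integral>\<^sup>+y. h K y \<partial>count_space (space P))" for K
  proof -
    have "(\<integral>\<^sup>+y. h K y \<partial>count_space (space P))
        = (\<integral>\<^sup>+y. ennreal ((1/4) ^ K) * indicator (large K) y \<partial>count_space (space P))"
      by (intro nn_integral_cong) (auto simp: h_def large_iff split: split_indicator)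
    also have "\<dots> = ennreal ((1/4) ^ K) * emeasure (count_space (space P)) (large K)"
      by (rule nn_integral_cmult_indicator) (auto simp: large_iff)
    also have "\<dots> = ennreal (card (large K) * (1/4) ^ K)"
      using finite_large[of K]
      by (subst emeasure_count_space)
         (auto simp: large_def ennreal_mult'' mult.commute ennreal_of_nat_eq_real_of_nat)
    finally show ?thesis by simp
  qed
  then have "(\<Sum>K. ennreal (card (large (Suc K)) * (1/4) ^ Suc K))
      = (\<Sum>K. \<integral>\<^sup>+y. h (Suc K) y \<partial>count_space (space P))"
    by presburger
  also have "\<dots> = (\<integral>\<^sup>+y. (\<Sum>K. h (Suc K) y) \<partial>count_space (space P))"
    by (rule nn_integral_suminf[symmetric]) simp
  also have "\<dots> \<le> (\<integral>\<^sup>+y. ennreal (4/3) * ennreal (sqrt (prob {y})) \<partial>count_space (space P))"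
  proof (intro nn_integral_mono suminf_le_const)
    fix y n
    have "(\<Sum>K<n. h (Suc K) y) \<le> (\<Sum>K<Suc n. h K y)"
      by (subst sum.lessThan_Suc_shift) (simp add: add_increasing)
    also have "\<dots> \<le> ennreal (4/3 * sqrt (prob {y}))"
      using ennreal_leI[OF sum_quarter_powers_below[of "sqrt (prob {y})" "Suc n"]]
      unfolding h_def by (subst sum_ennreal) (auto simp del: sum.lessThan_Suc)
    finally show "(\<Sum>K<n. h (Suc K) y) \<le> ennreal (4/3) * ennreal (sqrt (prob {y}))"
      by (simp flip: ennreal_mult)
  qed auto
  also have "\<dots> = ennreal (4/3) * (\<integral>\<^sup>+y. ennreal (sqrt (prob {y})) \<partial>count_space (space P))"
    by (rule nn_integral_cmult) simp
  finally show ?thesis .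
qed

text \<open>
The mass side of the Cauchy-Schwarz inequality. After exchanging the sums, an atom of mass \<open>q\<close>
collects \<open>4 * q\<close> times the powers \<open>4\<^sup>K\<close> that are at most \<open>1 / sqrt q\<close>. Only atoms that are light
at level \<open>m\<close> occur, since the sets of light atoms decrease.
\<close>

lemma suminf_prob_small_le:
  "(\<Sum>K. if m \<le> K then ennreal (prob (small K) * 4 ^ Suc K) else 0)
     \<le> ennreal (16/3) * (\<integral>\<^sup>+y. ennreal (sqrt (prob {y})) \<partial>count_space (small m))"
proof -
  define s where "s y = sqrt (prob {y})" for y
  have s: "0 \<le> s y" "prob {y} = s y * s y" for y
    by (simp_all add: s_def)
  define h where "h K y = ennreal (prob {y} * 4 ^ Suc K * (if s y \<le> (1/4) ^ K then 1 else 0))"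
    for K :: nat and y
  have "(if m \<le> K then ennreal (prob (small K) * 4 ^ Suc K) else 0)
      \<le> (\<integral>\<^sup>+y. h K y \<partial>count_space (small m))" for K
  proof (cases "m \<le> K")
    case True
    have "ennreal (prob (small K) * 4 ^ Suc K)
        = (\<integral>\<^sup>+y. ennreal (prob {y}) \<partial>count_space (small K)) * ennreal (4 ^ Suc K)"
      using emeasure_eq_nn_integral[OF small_subset, of K]
      by (simp add: emeasure_eq_measure ennreal_mult del: power_Suc)
    also have "\<dots> = (\<integral>\<^sup>+y. ennreal (prob {y}) * ennreal (4 ^ Suc K) \<partial>count_space (small K))"
      by (rule nn_integral_multc[symmetric]) simp
    also have "\<dots> \<le> (\<integral>\<^sup>+y. h K y \<partial>count_space (small m))"
      using small_antimono[OF True]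
      by (auto simp: nn_integral_count_space_indicator h_def s_def small_iff simp flip: ennreal_mult
          intro!: nn_integral_mono split: split_indicator)
    finally show ?thesis using True by simp
  qed simp
  then have "(\<Sum>K. if m \<le> K then ennreal (prob (small K) * 4 ^ Suc K) else 0)
      \<le> (\<Sum>K. \<integral>\<^sup>+y. h K y \<partial>count_space (small m))"
    by (intro suminf_le) auto
  also have "\<dots> = (\<integral>\<^sup>+y. (\<Sum>K. h K y) \<partial>count_space (small m))"
    by (rule nn_integral_suminf[symmetric]) simp
  also have "\<dots> \<le> (\<integral>\<^sup>+y. ennreal (16/3) * ennreal (s y) \<partial>count_space (small m))"
  proof (intro nn_integral_mono suminf_le_const)
    fix y n
    have "(\<Sum>K<n. prob {y} * 4 ^ Suc K * (if s y \<le> (1/4) ^ K then 1 else 0)) \<le> 16/3 * s y"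
    proof (cases "s y = 0")
      case False
      then have pos: "0 < s y"
        using s(1)[of y] by simp
      have iff: "s y \<le> (1/4) ^ K \<longleftrightarrow> 4 ^ K \<le> 1 / s y" for K
        using pos by (simp add: power_one_over field_simps)
      have "(\<Sum>K<n. prob {y} * 4 ^ Suc K * (if s y \<le> (1/4) ^ K then 1 else 0))
          = 4 * (s y * s y) * (\<Sum>K<n. 4 ^ K * (if 4 ^ K \<le> 1 / s y then 1 else 0))"
        by (simp add: s(2) iff sum_distrib_left mult_ac cong: if_cong)
      also have "\<dots> \<le> 4 * (s y * s y) * (4/3 * (1 / s y))"
        using pos by (intro mult_left_mono sum_powers_of_four_below) auto
      finally show ?thesis using pos by simp
    qed (simp add: s(2))
    then have "(\<Sum>K<n. h K y) \<le> ennreal (16/3 * s y)"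
      unfolding h_def by (subst sum_ennreal) (auto intro!: ennreal_leI)
    then show "(\<Sum>K<n. h K y) \<le> ennreal (16/3) * ennreal (s y)"
      using s(1)[of y] by (simp flip: ennreal_mult)
  qed auto
  also have "\<dots> = ennreal (16/3) * (\<integral>\<^sup>+y. ennreal (s y) \<partial>count_space (small m))"
    by (rule nn_integral_cmult) simp
  finally show ?thesis by (simp add: s_def)
qed

theorem bracketing_integral_indicators_le:
  assumes "1 \<le> p"
  shows "bracketing_integral (ereal (2 powi (- (int p - 1)))) (indicators (space P)) P
     \<le> ennreal (16/3) * ennsqrt (\<Sum>\<^sub>\<infinity>y\<in>space P. ennreal (sqrt (prob {y})))
        * ennsqrt (\<Sum>\<^sub>\<infinity>y\<in>small_atoms P (16 powi (- int (jj P p) + 1)). ennreal (sqrt (prob {y})))"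
proof -
  \<comment> \<open>The light atoms at level \<open>m\<close> are those of the second sum, with threshold \<open>16\<^bsup>1 - jj P p\<^esup>\<close>.\<close>
  obtain m where m: "jj P p = Suc m"
    using jj_pos[OF assms] by (cases "jj P p") auto
  define S S' where "S = (\<integral>\<^sup>+y. ennreal (sqrt (prob {y})) \<partial>count_space (space P))"
    and "S' = (\<integral>\<^sup>+y. ennreal (sqrt (prob {y})) \<partial>count_space (small m))"
  have "((1/2) ^ p)\<^sup>2 < prob (small m)"
    using prob_small_before_jj[of m p] m by (simp add: power2_eq_square flip: power_mult_distrib)
  then have "(1/2) ^ p \<le> sqrt (prob (small m))"
    by (intro real_le_rsqrt) simp
  moreover have "(2::real) powi (- (int p - 1)) = 2 * (1/2) ^ p"
    by (simp add: power_int_diff power_one_over field_simps power_int_minus)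
  ultimately have "bracketing_integral (ereal (2 powi (- (int p - 1)))) (indicators (space P)) P
    \<le> (\<Sum>K. (if m \<le> K then ennreal (sqrt (card (large (Suc K)))) else 0)
            * ennreal (2 * sqrt (prob (small K))))"
    by (intro bracketing_integral_le_suminf) simp
  \<comment> \<open>The weights \<open>4\<^bsup>K + 1\<^esup>\<close> balance the two factors: they turn both sums into geometric ones.\<close>
  also have "\<dots> = (\<Sum>K. ennreal 2 * (ennreal (sqrt (card (large (Suc K)) * (1/4) ^ Suc K))
      * (if m \<le> K then ennreal (sqrt (prob (small K) * 4 ^ Suc K)) else 0)))"
  proof (intro suminf_cong)
    fix K
    have "sqrt (card (large (Suc K))) * (2 * sqrt (prob (small K)))
        = 2 * (sqrt (card (large (Suc K)) * (1/4) ^ Suc K) * sqrt (prob (small K) * 4 ^ Suc K))"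
      by (simp add: real_sqrt_mult power_one_over real_sqrt_divide del: power_Suc)
    then show "(if m \<le> K then ennreal (sqrt (card (large (Suc K)))) else 0)
            * ennreal (2 * sqrt (prob (small K)))
        = ennreal 2 * (ennreal (sqrt (card (large (Suc K)) * (1/4) ^ Suc K))
            * (if m \<le> K then ennreal (sqrt (prob (small K) * 4 ^ Suc K)) else 0))"
      by (simp del: ennreal_numeral power_Suc flip: ennreal_mult)
  qed
  also have "\<dots> = ennreal 2 * (\<Sum>K. ennreal (sqrt (card (large (Suc K)) * (1/4) ^ Suc K))
      * (if m \<le> K then ennreal (sqrt (prob (small K) * 4 ^ Suc K)) else 0))"
    by (rule ennreal_suminf_cmult)
  also have "\<dots> \<le> ennreal 2 * (ennsqrt (\<Sum>K. (ennreal (sqrt (card (large (Suc K)) * (1/4) ^ Suc K)))\<^sup>2)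
      * ennsqrt (\<Sum>K. (if m \<le> K then ennreal (sqrt (prob (small K) * 4 ^ Suc K)) else 0)\<^sup>2))"
    by (intro mult_left_mono suminf_Cauchy_Schwarz) simp
  also have "\<dots> = ennreal 2 * (ennsqrt (\<Sum>K. ennreal (card (large (Suc K)) * (1/4) ^ Suc K))
      * ennsqrt (\<Sum>K. if m \<le> K then ennreal (prob (small K) * 4 ^ Suc K) else 0))"
    by (simp add: if_distrib[of "\<lambda>x. x\<^sup>2"] ennreal_power del: power_Suc cong: if_cong)
  also have "\<dots> \<le> ennreal 2 * (ennsqrt (ennreal (4/3) * S) * ennsqrt (ennreal (16/3) * S'))"
    unfolding S_def S'_def
    by (intro mult_left_mono mult_mono ennsqrt_mono suminf_card_large_le suminf_prob_small_le) auto
  also have "\<dots> = ennreal (2 * (sqrt (4/3) * sqrt (16/3))) * ennsqrt S * ennsqrt S'"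
    by (simp add: ennsqrt_mult ennsqrt_ennreal ennreal_mult mult_ac)
  also have "2 * (sqrt (4/3) * sqrt (16/3)) = (16/3::real)"
  proof -
    have "sqrt (4/3) * sqrt (16/3) = sqrt ((8/3)\<^sup>2)"
      by (simp add: power2_eq_square flip: real_sqrt_mult)
    then show ?thesis by simp
  qed
  finally show ?thesis
    using m small_subset[of m]
    by (simp add: S_def S'_def small_def infsum_eq_nn_integral_count_space
        countable_space countable_subset[OF _ countable_space])
qed

end

section \<open>Transport along a bijection\<close>

lemma L2_enorm_distr:
  assumes f: "f \<in> P \<rightarrow>\<^sub>M count_space UNIV"
  shows "L2_enorm (distr P (count_space UNIV) f) g = L2_enorm P (\<lambda>x. g (f x))"
  unfolding L2_enorm_def by (subst nn_integral_distr[OF f]) auto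

text \<open>
Brackets for the image measure pull back along \<open>f\<close>. Injectivity is what turns the indicator of the
image of \<open>C\<close> back into the indicator of \<open>C\<close>.
\<close>

lemma bracketing_number_indicators_le_distr:
  assumes f: "f \<in> P \<rightarrow>\<^sub>M count_space UNIV" and inj: "inj_on f (space P)"
  shows "bracketing_number \<epsilon> (indicators (space P)) P
    \<le> bracketing_number \<epsilon> (indicators UNIV) (distr P (count_space UNIV) f)"
  unfolding bracketing_number_def
proof (rule Inf_mono, safe)
  fix B assume B: "finite B"
      "\<forall>(l, u)\<in>B. L2_enorm (distr P (count_space UNIV) f) (\<lambda>x. u x - l x) < ennreal \<epsilon>"
      "indicators UNIV \<subseteq> (\<Union>(l, u)\<in>B. bracket (space (distr P (count_space UNIV) f)) l u)"
  define B' where "B' = map_prod (\<lambda>l. l \<circ> f) (\<lambda>u. u \<circ> f) ` B"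
  have fin: "finite B'"
    using B(1) by (simp add: B'_def)
  have norm: "\<forall>(l, u)\<in>B'. L2_enorm P (\<lambda>x. u x - l x) < ennreal \<epsilon>"
    using B(2) by (force simp: B'_def L2_enorm_distr[OF f])
  have cover: "indicators (space P) \<subseteq> (\<Union>(l, u)\<in>B'. bracket (space P) l u)"
  proof
    fix g :: "'a \<Rightarrow> real" assume "g \<in> indicators (space P)"
    then obtain C where C: "C \<subseteq> space P" "g = indicator C"
      by (auto simp: indicators_def)
    have "(indicator (f ` C) :: 'b \<Rightarrow> real) \<in> indicators UNIV"
      by (auto simp: indicators_def)
    then obtain l u where lu: "(l, u) \<in> B" "indicator (f ` C) \<in> bracket UNIV l u"
      using B(3) by auto
    have "g x = indicator (f ` C) (f x)" if "x \<in> space P" for x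
      using that C inj by (auto simp: inj_on_def split: split_indicator)
    then have "g \<in> bracket (space P) (l \<circ> f) (u \<circ> f)"
      using lu(2) by (simp add: bracket_def)
    then show "g \<in> (\<Union>(l, u)\<in>B'. bracket (space P) l u)"
      using lu(1) by (force simp: B'_def)
  qed
  have "card B' \<le> card B"
    unfolding B'_def by (rule card_image_le[OF B(1)])
  then show "\<exists>a\<in>{enat (card B) |B. finite B \<and> (\<forall>(l, u)\<in>B. L2_enorm P (\<lambda>x. u x - l x) < ennreal \<epsilon>) \<and>
      indicators (space P) \<subseteq> (\<Union>(l, u)\<in>B. bracket (space P) l u)}. a \<le> enat (card B)"
    using fin norm cover by (intro bexI[of _ "enat (card B')"]) auto
qed

definition entropy_bound :: "real \<Rightarrow> 'a measure \<Rightarrow> nat \<Rightarrow> bool" where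
  "entropy_bound C P p \<longleftrightarrow>
     bracketing_integral (ereal (2 powi (- (int p - 1)))) (indicators (space P)) P
     \<le> ennreal C
        * ennsqrt (\<Sum>\<^sub>\<infinity>y\<in>space P. ennreal (sqrt (measure P {y})))
        * ennsqrt (\<Sum>\<^sub>\<infinity>y\<in>small_atoms P (16 powi (- int (jj P p) + 1)).
                     ennreal (sqrt (measure P {y})))"

lemma entropy_bound_of_distr:
  fixes P :: "'a measure" and f :: "'a \<Rightarrow> 'b"
  assumes sets: "sets P = Pow (space P)" and bij: "bij_betw f (space P) UNIV"
    and bound: "entropy_bound C (distr P (count_space UNIV) f) p"
  shows "entropy_bound C P p"
proof -
  define Q where "Q = distr P (count_space UNIV) f"
  have f: "f \<in> P \<rightarrow>\<^sub>M count_space UNIV"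
    by (simp add: measurable_def sets)
  have inj: "inj_on f (space P)" and surj: "f ` space P = UNIV"
    using bij by (auto simp: bij_betw_def)
  have measure_Q: "measure Q {f y} = measure P {y}" if "y \<in> space P" for y
  proof -
    have "f -` {f y} \<inter> space P = {y}"
      using that inj by (auto simp: inj_on_def)
    then show ?thesis
      by (simp add: Q_def measure_distr[OF f])
  qed
  have small_Q: "small_atoms Q t = f ` small_atoms P t" for t
  proof -
    have "small_atoms Q t = {z \<in> f ` space P. measure Q {z} \<le> t}"
      by (simp add: small_atoms_def surj) (simp add: Q_def)
    also have "\<dots> = f ` small_atoms P t"
      using measure_Q by (auto simp: small_atoms_def)
    finally show ?thesis .
  qed
  have infsum_Q: "(\<Sum>\<^sub>\<infinity>z\<in>f ` A. g (measure Q {z})) = (\<Sum>\<^sub>\<infinity>y\<in>A. g (measure P {y}))"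
    if "A \<subseteq> space P" for A and g :: "real \<Rightarrow> ennreal"
  proof -
    have "(\<Sum>\<^sub>\<infinity>z\<in>f ` A. g (measure Q {z})) = (\<Sum>\<^sub>\<infinity>y\<in>A. g (measure Q {f y}))"
      using inj_on_subset[OF inj that] by (simp add: infsum_reindex comp_def)
    also have "\<dots> = (\<Sum>\<^sub>\<infinity>y\<in>A. g (measure P {y}))"
      using that measure_Q by (intro infsum_cong) auto
    finally show ?thesis .
  qed
  have small_sub: "small_atoms P t \<subseteq> space P" for t
    by (auto simp: small_atoms_def)
  have jj_Q: "jj Q = jj P"
    unfolding jj_def small_Q infsum_Q[OF small_sub] ..
  have space_Q: "space Q = f ` space P"
    by (simp add: Q_def surj)
  have "bracketing_integral \<delta> (indicators (space P)) P \<le> bracketing_integral \<delta> (indicators (space Q)) Q" for \<delta>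
    unfolding bracketing_integral_def Q_def
    by (intro nn_integral_mono mult_right_mono sqrt_log_mono)
       (auto intro: bracketing_number_indicators_le_distr[OF f inj])
  also note bound[unfolded entropy_bound_def, folded Q_def]
  finally show ?thesis
    unfolding entropy_bound_def jj_Q small_Q space_Q
      infsum_Q[OF small_sub, of "\<lambda>r. ennreal (sqrt r)"]
      infsum_Q[OF order_refl, of "\<lambda>r. ennreal (sqrt r)"] .
qed

text \<open>
The constant \<open>C2\<close> is an unspecified choice among the positive constants that work for carriers of
natural numbers. Since \<open>16/3\<close> is one of them, the choice is not void and \<open>C2\<close> works there as well.
\<close>

lemma C2_works_on_nat:
  "C2 > 0" "discrete_prob_space P \<Longrightarrow> infinite (space P) \<Longrightarrow> 1 \<le> p \<Longrightarrow> entropy_bound C2 P p"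
  for P :: "nat measure"
proof -
  define works where "works C \<longleftrightarrow> C > 0 \<and> (\<forall>(X :: nat set) P. infinite X \<and> countable X \<and>
        prob_space P \<and> space P = X \<and> sets P = Pow X \<longrightarrow> (\<forall>p\<ge>1.
           bracketing_integral (ereal (2 powi (- (int p - 1)))) (indicators X) P
           \<le> ennreal C
              * ennsqrt (\<Sum>\<^sub>\<infinity>y\<in>X. ennreal (sqrt (measure P {y})))
              * ennsqrt (\<Sum>\<^sub>\<infinity>y\<in>small_atoms P (16 powi (- int (jj P p) + 1)).
                           ennreal (sqrt (measure P {y})))))" for C
  have "works (16/3)"
    using discrete_prob_space.bracketing_integral_indicators_le[where 'a = nat]
    unfolding works_def by (auto simp: discrete_prob_space_def discrete_prob_space_axioms_def)
  then have "works C2"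
    unfolding C2_def works_def by (rule someI)
  then show "C2 > 0" "discrete_prob_space P \<Longrightarrow> infinite (space P) \<Longrightarrow> 1 \<le> p \<Longrightarrow> entropy_bound C2 P p"
    unfolding works_def entropy_bound_def
    by (auto simp: discrete_prob_space_def discrete_prob_space_axioms_def)
qed

lemma (in discrete_prob_space) entropy_bound_C2:
  assumes "infinite (space P)" "1 \<le> p"
  shows "entropy_bound C2 P p"
proof (rule entropy_bound_of_distr[OF sets_eq])
  let ?f = "to_nat_on (space P)"
  let ?Q = "distr P (count_space UNIV) ?f"
  show "bij_betw ?f (space P) UNIV"
    using countable_space assms(1) by (rule to_nat_on_infinite)
  have "prob_space ?Q"
    by (rule prob_space_distr) (simp add: measurable_def sets_eq)
  then have "discrete_prob_space ?Q"
    by (simp add: discrete_prob_space_def discrete_prob_space_axioms_def)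
  then show "entropy_bound C2 ?Q p"
    using assms(2) by (intro C2_works_on_nat) auto
qed

theorem lemma8:
  shows "C2 > 0 \<and>
     (\<forall>(X :: 'a set) P. infinite X \<and> countable X \<and>
        prob_space P \<and> space P = X \<and> sets P = Pow X \<longrightarrow>
        (\<forall>p::nat. p \<ge> 1 \<longrightarrow>
           bracketing_integral (ereal (2 powi (- (int p - 1)))) (indicators X) P
           \<le> ennreal C2
              * ennsqrt (\<Sum>\<^sub>\<infinity>y\<in>X. ennreal (sqrt (measure P {y})))
              * ennsqrt (\<Sum>\<^sub>\<infinity>y\<in>small_atoms P (16 powi (- int (jj P p) + 1)).
                           ennreal (sqrt (measure P {y})))) \<and>
        (infinite {y \<in> X. measure P {y} > 0} \<longrightarrow> filterlim (jj P) at_top at_top))"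
proof (intro conjI allI impI)
  show "C2 > 0"
    by (rule C2_works_on_nat)
next
  fix X :: "'a set" and P :: "'a measure" and p :: nat
  assume "infinite X \<and> countable X \<and> prob_space P \<and> space P = X \<and> sets P = Pow X" and p: "p \<ge> 1"
  then have P: "discrete_prob_space P" "infinite (space P)" "space P = X"
    by (auto simp: discrete_prob_space_def discrete_prob_space_axioms_def)
  show "bracketing_integral (ereal (2 powi (- (int p - 1)))) (indicators X) P
           \<le> ennreal C2
              * ennsqrt (\<Sum>\<^sub>\<infinity>y\<in>X. ennreal (sqrt (measure P {y})))
              * ennsqrt (\<Sum>\<^sub>\<infinity>y\<in>small_atoms P (16 powi (- int (jj P p) + 1)).
                           ennreal (sqrt (measure P {y})))"
    using discrete_prob_space.entropy_bound_C2[OF P(1,2) p] by (simp only: entropy_bound_def P(3))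
next
  fix X :: "'a set" and P :: "'a measure"
  assume "infinite X \<and> countable X \<and> prob_space P \<and> space P = X \<and> sets P = Pow X"
    and inf: "infinite {y \<in> X. measure P {y} > 0}"
  then have "discrete_prob_space P" "space P = X"
    by (auto simp: discrete_prob_space_def discrete_prob_space_axioms_def)
  with inf show "filterlim (jj P) at_top at_top"
    using discrete_prob_space.filterlim_jj by blast
qed

end
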